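(* Let $X$ be a connected graph such that $T_2(X)=kP_2$ for some integer $k\ge 2$. If $k=2$, then $X=P_4$ or $X=CP_4$; if $k\ge 3$, then $X=CP_{2k}$.
   Context: All graphs are finite and simple, but not necessarily connected; equality of graphs means graph isomorphism. The $2$-distance graph $T_2(X)$ of a graph $X$ is the graph with vertex set $V(X)$ in which $u,v$ are adjacent if and only if their distance in $X$ (length of a shortest $u$-$v$ path, $\infty$ if they lie in different components) is exactly $2$. $P_r$ denotes the path of order $r$ (with $r$ vertices), and $kP_2$ is the disjoint union of $k$ copies of $P_2$. For $n\ge 2$, the cocktail party graph $CP_{2n}$ of order $2n$ is the graph with vertex set $\{u_1,\ldots,u_n,v_1,\ldots,v_n\}$ obtained from the complete graph $K_{2n}$ on these vertices by deleting the edges $u_iv_i$, $i=1,\ldots,n$. *)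

theory Defs
  imports "Graph_Theory.Graph_Theory"
begin

text \<open>
  Finite simple graphs are the symmetric loop-free pair digraphs of the locale
  \<^locale>\<open>pair_graph\<close>; an edge is a pair of opposite arcs.  Note that
  \<^const>\<open>connected\<close> requires a non-empty vertex set.
\<close>

text \<open>Shortest-path cost with all arcs of weight 1; it is \<open>\<infinity>\<close> between different components.\<close>

definition graph_dist :: "'a pair_pre_digraph \<Rightarrow> 'a \<Rightarrow> 'a \<Rightarrow> ereal" where
  "graph_dist G u v = wf_digraph.\<mu> (with_proj G) (\<lambda>_. 1) u v"

definition two_distance_graph :: "'a pair_pre_digraph \<Rightarrow> 'a pair_pre_digraph" where
  "two_distance_graph G =
    \<lparr> pverts = pverts G,
      parcs = {(u, v). u \<in> pverts G \<and> v \<in> pverts G \<and> graph_dist G u v = 2} \<rparr>"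

text \<open>The path of order \<open>r\<close>, that is, with \<open>r\<close> vertices.\<close>

definition path_graph :: "nat \<Rightarrow> nat pair_pre_digraph" where
  "path_graph r =
    \<lparr> pverts = {..<r},
      parcs = {(i, j). i < r \<and> j < r \<and> (j = Suc i \<or> i = Suc j)} \<rparr>"

definition disjoint_copies :: "nat \<Rightarrow> 'a pair_pre_digraph \<Rightarrow> (nat \<times> 'a) pair_pre_digraph" where
  "disjoint_copies k G =
    \<lparr> pverts = {..<k} \<times> pverts G,
      parcs = {((i, u), (j, v)). i < k \<and> i = j \<and> (u, v) \<in> parcs G} \<rparr>"

text \<open>
  The cocktail party graph of order \<open>2 * n\<close> (the argument is half of the order), with
  \<open>Inl i\<close> for \<open>u\<^sub>i\<close> and \<open>Inr i\<close> for \<open>v\<^sub>i\<close>.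
\<close>

definition cocktail_party_graph :: "nat \<Rightarrow> (nat + nat) pair_pre_digraph" where
  "cocktail_party_graph n =
    (let V = Inl ` {1..n} \<union> Inr ` {1..n} in
      \<lparr> pverts = V,
        parcs = {(x, y). x \<in> V \<and> y \<in> V \<and> x \<noteq> y}
          - (\<Union>i\<in>{1..n}. {(Inl i, Inr i), (Inr i, Inl i)}) \<rparr>)"

definition graph_iso :: "'a pair_pre_digraph \<Rightarrow> 'b pair_pre_digraph \<Rightarrow> bool" (infix \<open>\<simeq>\<^sub>g\<close> 50) where
  "G \<simeq>\<^sub>g H \<longleftrightarrow> digraph_iso (with_proj G) (with_proj H)"

end

theory Submission
  imports Defs
begin

text \<open>
  In \<open>T\<^sub>2(X) = kP\<^sub>2\<close> every vertex of \<open>X\<close> has exactly one vertex at distance 2, its partner.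
  The shape of \<open>X\<close> comes from the fact that two distinct vertices with a common neighbour are
  adjacent unless they are partners.

  Fix a vertex \<open>u\<close>.  If the ball of radius 2 around \<open>u\<close> is not all of \<open>X\<close>, connectedness gives an
  edge \<open>cd\<close> leaving it.  Here \<open>c\<close> is neither \<open>u\<close> nor a neighbour of \<open>u\<close>, so it is at distance 2
  from \<open>u\<close>, through some \<open>b\<close>, and \<open>u, b, c, d\<close> is an induced path whose partner pairs are
  \<open>{u, c}\<close> and \<open>{b, d}\<close>.  A further vertex adjacent to one vertex of this path would be adjacent to
  all four, hence a common neighbour of the ends \<open>u\<close> and \<open>d\<close>, which are not partners.  By
  connectedness there is no further vertex, and \<open>X = P\<^sub>4\<close>
  (\<open>diameter_two_or_path4\<close>).

  If no such \<open>u\<close> exists, distinct vertices are adjacent exactly when they are not partners, so \<open>X\<close> is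
  the complement of the perfect matching \<open>T\<^sub>2(X)\<close>, that is, \<open>CP\<^bsub>2k\<^esub>\<close>
  (\<open>cocktail_party_if_complement\<close>).  Counting vertices, \<open>P\<^sub>4\<close> leaves only \<open>k = 2\<close>.
\<close>

section \<open>Isomorphism as an adjacency-preserving bijection\<close>

text \<open>
  The library's isomorphisms map vertices and arcs separately.  Since an arc of a pair digraph is
  the pair of its ends, the vertex map determines the arc map.
\<close>

lemma graph_iso_obtain_bij:
  assumes "G \<simeq>\<^sub>g H"
  obtains f where "bij_betw f (pverts G) (pverts H)"
    and "\<And>u v. u \<in> pverts G \<Longrightarrow> v \<in> pverts G \<Longrightarrow> (f u, f v) \<in> parcs H \<longleftrightarrow> (u, v) \<in> parcs G"
proof -
  obtain h where h: "pre_digraph.digraph_isomorphism (with_proj G) h"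
    and H: "with_proj H = app_iso h (with_proj G)"
    using assms unfolding graph_iso_def digraph_iso_def by blast
  let ?f = "iso_verts h"
  have wf: "wf_digraph (with_proj G)" and inj: "inj_on ?f (pverts G)"
    and ends: "\<And>a. a \<in> parcs G \<Longrightarrow>
      ?f (fst a) = iso_tail h (iso_arcs h a) \<and> ?f (snd a) = iso_head h (iso_arcs h a)"
    using h by (auto simp: pre_digraph.digraph_isomorphism_def)
  have verts: "pverts H = ?f ` pverts G" and arcs: "parcs H = iso_arcs h ` parcs G"
    and tl: "iso_tail h = fst" and hd: "iso_head h = snd"
    using arg_cong[OF H, of verts] arg_cong[OF H, of arcs]
      arg_cong[OF H, of tail] arg_cong[OF H, of head] by simp_all
  have im: "iso_arcs h a = (?f (fst a), ?f (snd a))" if "a \<in> parcs G" for a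
    using ends[OF that] by (simp add: tl hd prod_eq_iff)
  interpret pair_wf_digraph G using wf by (simp add: wf_digraph_wp_iff)
  have "(?f u, ?f v) \<in> parcs H \<longleftrightarrow> (u, v) \<in> parcs G" if "u \<in> pverts G" "v \<in> pverts G" for u v
  proof
    assume "(?f u, ?f v) \<in> parcs H"
    then obtain x y where xy: "(x, y) \<in> parcs G" "?f u = ?f x" "?f v = ?f y"
      using arcs im by force
    then show "(u, v) \<in> parcs G"
      using inj_onD[OF inj] that in_arcsD1 in_arcsD2 by metis
  next
    assume "(u, v) \<in> parcs G"
    then show "(?f u, ?f v) \<in> parcs H" using arcs im by force
  qed
  with inj verts show thesis by (intro that[of ?f]) (auto simp: bij_betw_def)
qed

lemma graph_isoI:
  assumes "pair_wf_digraph G" "pair_wf_digraph H" and f: "bij_betw f (pverts G) (pverts H)"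
    and adj: "\<And>u v. u \<in> pverts G \<Longrightarrow> v \<in> pverts G \<Longrightarrow> (f u, f v) \<in> parcs H \<longleftrightarrow> (u, v) \<in> parcs G"
  shows "G \<simeq>\<^sub>g H"
proof -
  interpret G: pair_wf_digraph G by fact
  interpret H: pair_wf_digraph H by fact
  let ?h = "\<lparr>iso_verts = f, iso_arcs = map_prod f f, iso_head = snd, iso_tail = fst\<rparr>"
  have inj: "inj_on f (pverts G)" and im: "f ` pverts G = pverts H"
    using f by (auto simp: bij_betw_def)
  have sub: "parcs G \<subseteq> pverts G \<times> pverts G"
    using G.wellformed' by auto
  have "inj_on (map_prod f f) (parcs G)"
    using map_prod_inj_on[OF inj inj] sub by (rule inj_on_subset)
  then have "pre_digraph.digraph_isomorphism (with_proj G) ?h"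
    using inj assms(1) by (auto simp: pre_digraph.digraph_isomorphism_def wf_digraph_wp_iff)
  moreover have "parcs H = map_prod f f ` parcs G"
  proof
    show "map_prod f f ` parcs G \<subseteq> parcs H"
      using adj G.wellformed' by auto
    show "parcs H \<subseteq> map_prod f f ` parcs G"
    proof
      fix a assume a: "a \<in> parcs H"
      then have "fst a \<in> f ` pverts G" "snd a \<in> f ` pverts G"
        using im H.arc_fst_in_verts H.arc_snd_in_verts by auto
      then obtain u v where uv: "u \<in> pverts G" "v \<in> pverts G" "a = (f u, f v)"
        by (metis imageE prod.collapse)
      with a adj have "(u, v) \<in> parcs G" by simp
      with uv(3) show "a \<in> map_prod f f ` parcs G" by (auto intro: rev_image_eqI)
    qed
  qed
  then have "with_proj H = app_iso ?h (with_proj G)"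
    using im by (simp add: with_proj_def app_iso_def)
  ultimately show ?thesis
    unfolding graph_iso_def digraph_iso_def by blast
qed

section \<open>Distance two and connectedness\<close>

text \<open>
  With unit weights a walk costs its length, so an infimum below 3 is attained by a walk of at most
  two arcs.
\<close>

lemma (in pair_wf_digraph) graph_dist_eq_2_iff:
  assumes u: "u \<in> pverts G"
  shows "graph_dist G u v = 2 \<longleftrightarrow>
    u \<noteq> v \<and> (u, v) \<notin> parcs G \<and> (\<exists>w. (u, w) \<in> parcs G \<and> (w, v) \<in> parcs G)"
    (is "_ \<longleftrightarrow> ?R")
proof -
  have cost: "awalk_cost (\<lambda>_. 1) p = length p" for p
    by (induct p) auto
  have le: "graph_dist G u v \<le> length p" if "awalk u p v" for p
    using min_cost_le_walk_cost[OF that, of "\<lambda>_. 1"] by (simp add: cost graph_dist_def)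
  have nil: "awalk u [] v \<longleftrightarrow> u = v"
    using u by (simp add: awalk_Nil_iff)
  have one: "awalk u [(x, y)] v \<longleftrightarrow> x = u \<and> y = v \<and> (u, v) \<in> parcs G" for x y
    using u by (auto simp: awalk_def)
  have two: "awalk u [(x, y), (x', y')] v \<longleftrightarrow>
      x = u \<and> x' = y \<and> y' = v \<and> (u, y) \<in> parcs G \<and> (y, v) \<in> parcs G" for x y x' y'
    using u by (auto simp: awalk_def)
  show ?thesis
  proof
    assume d: "graph_dist G u v = 2"
    have far: "u \<noteq> v" "(u, v) \<notin> parcs G"
      using d le[of "[]"] le[of "[(u, v)]"] nil one by auto
    have "(INF p\<in>{p. awalk u p v}. ereal (length p)) < 3"
      using d by (simp add: graph_dist_def \<mu>_def cost)
    then obtain p where p: "awalk u p v" "length p < 3"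
      by (auto simp: INF_less_iff)
    have "length p \<noteq> 0" "length p \<noteq> 1"
      using p(1) far nil one by (auto simp: length_Suc_conv)
    with p(2) have "length p = 2" by linarith
    then obtain e e' where "p = [e, e']"
      by (auto simp: numeral_2_eq_2 length_Suc_conv)
    with p(1) two show ?R
      using far by (metis prod.collapse)
  next
    assume R: ?R
    then obtain w where "awalk u [(u, w), (w, v)] v"
      using two by blast
    from le[OF this] have "graph_dist G u v \<le> 2" by simp
    moreover have "2 \<le> graph_dist G u v"
      unfolding graph_dist_def \<mu>_def
    proof (rule INF_greatest)
      fix p assume "p \<in> {p. awalk u p v}"
      then have "length p \<noteq> 0" "length p \<noteq> 1"
        using R nil one by (auto simp: length_Suc_conv)
      then have "2 \<le> length p" by linarith
      then show "2 \<le> ereal (awalk_cost (\<lambda>_. 1) p)"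
        by (simp add: cost)
    qed
    ultimately show "graph_dist G u v = 2" by (rule antisym)
  qed
qed

lemma (in pair_graph) connected_escape:
  assumes conn: "connected (with_proj G)"
    and "x \<in> S" "x \<in> pverts G" "y \<in> pverts G" "y \<notin> S"
  obtains s t where "(s, t) \<in> parcs G" "s \<in> S" "t \<notin> S"
proof (rule ccontr)
  assume no: "\<not> thesis"
  have "x \<rightarrow>\<^sup>*\<^bsub>with_proj (mk_symmetric (with_proj G))\<^esub> y"
    using conn assms(3,4) by (auto simp: connected_def strongly_connected_def)
  then have "x \<rightarrow>\<^sup>*\<^bsub>with_proj G\<^esub> y"
    by (simp add: reachable_mk_symmetric_eq sym_arcs)
  then have "y \<in> S"
    by (induct rule: reachable_induct) (use assms(2) no that in auto)
  with assms(5) show False by simp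
qed

section \<open>Connected graphs whose 2-distance graph has maximum degree one\<close>

lemma (in pair_graph) path_graph_4I:
  assumes V: "pverts G = {a, b, c, d}" and dist: "distinct [a, b, c, d]"
    and edges: "(a, b) \<in> parcs G" "(b, c) \<in> parcs G" "(c, d) \<in> parcs G"
    and non_edges: "(a, c) \<notin> parcs G" "(b, d) \<notin> parcs G" "(a, d) \<notin> parcs G"
  shows "G \<simeq>\<^sub>g path_graph 4"
proof (rule graph_isoI)
  define f where "f = (\<lambda>_. 3 :: nat)(a := 0, b := 1, c := 2)"
  have f: "f a = 0" "f b = 1" "f c = 2" "f d = 3"
    using dist by (auto simp: f_def)
  show "pair_wf_digraph G" ..
  show "pair_wf_digraph (path_graph 4)"
    by unfold_locales (auto simp: path_graph_def)
  have "{..<4} = {0, 1, 2, 3 :: nat}" by auto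
  then show "bij_betw f (pverts G) (pverts (path_graph 4))"
    by (simp add: bij_betw_def inj_on_def path_graph_def V f)
  have reversed: "(b, a) \<in> parcs G" "(c, b) \<in> parcs G" "(d, c) \<in> parcs G"
    "(c, a) \<notin> parcs G" "(d, b) \<notin> parcs G" "(d, a) \<notin> parcs G"
    using edges non_edges arcs_symmetric by blast+
  have loops: "(x, x) \<notin> parcs G" for x
    using no_loops' by blast
  fix u v assume "u \<in> pverts G" "v \<in> pverts G"
  then have "u = a \<or> u = b \<or> u = c \<or> u = d" "v = a \<or> v = b \<or> v = c \<or> v = d"
    by (simp_all add: V)
  then show "(f u, f v) \<in> parcs (path_graph 4) \<longleftrightarrow> (u, v) \<in> parcs G"
    by (elim disjE; hypsubst) (simp_all add: path_graph_def f edges non_edges reversed loops)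
qed

text \<open>
  An edge that leaves a ball of radius 2 completes an induced \<open>P\<^sub>4\<close>.  The vertices at distance 2
  from each of its four vertices are then used up, so a fifth vertex cannot be attached without
  creating a second one.
\<close>

lemma (in pair_graph) diameter_two_or_path4:
  assumes conn: "connected (with_proj G)"
    and uniq: "\<And>u v w. u \<in> pverts G \<Longrightarrow> graph_dist G u v = 2 \<Longrightarrow> graph_dist G u w = 2 \<Longrightarrow> v = w"
  shows "G \<simeq>\<^sub>g path_graph 4 \<or>
    (\<forall>u\<in>pverts G. \<forall>v\<in>pverts G. u \<noteq> v \<longrightarrow> (u, v) \<in> parcs G \<or> graph_dist G u v = 2)"
proof (rule disjCI)
  assume "\<not> (\<forall>u\<in>pverts G. \<forall>v\<in>pverts G. u \<noteq> v \<longrightarrow> (u, v) \<in> parcs G \<or> graph_dist G u v = 2)"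
  then obtain a v where a: "a \<in> pverts G" and v: "v \<in> pverts G" "v \<noteq> a" "(a, v) \<notin> parcs G"
      "graph_dist G a v \<noteq> 2"
    by blast
  have sym: "(y, x) \<in> parcs G" if "(x, y) \<in> parcs G" for x y
    using that by (rule arcs_symmetric)
  have dist2: "graph_dist G x z = 2"
    if "(x, y) \<in> parcs G" "(y, z) \<in> parcs G" "x \<noteq> z" "(x, z) \<notin> parcs G" for x y z
    using that in_arcsD1[OF that(1)] graph_dist_eq_2_iff by blast
  \<comment> \<open>The edge \<open>cd\<close> leaves the ball of radius 2 around \<open>a\<close>, which misses \<open>v\<close>.\<close>
  obtain c d where cd: "(c, d) \<in> parcs G"
    and c: "c = a \<or> (a, c) \<in> parcs G \<or> graph_dist G a c = 2"
    and d: "d \<noteq> a" "(a, d) \<notin> parcs G" "graph_dist G a d \<noteq> 2"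
    using connected_escape[OF conn, of a "{x. x = a \<or> (a, x) \<in> parcs G \<or> graph_dist G a x = 2}" v]
      a v unfolding mem_Collect_eq by metis
  have c2: "graph_dist G a c = 2"
    using c cd d dist2[of a c d] by blast
  then obtain b where b: "(a, b) \<in> parcs G" "(b, c) \<in> parcs G" "a \<noteq> c" "(a, c) \<notin> parcs G"
    using a graph_dist_eq_2_iff by blast
  have bd: "b \<noteq> d" "(b, d) \<notin> parcs G"
    using b(1) d dist2[of a b d] by auto
  have d2: "graph_dist G b d = 2"
    using b(2) cd bd by (rule dist2)
  have verts: "{a, b, c, d} \<subseteq> pverts G"
    using b cd a in_arcsD1 in_arcsD2 by blast
  have swap: "graph_dist G z x = 2" if "x \<in> pverts G" "z \<in> pverts G" "graph_dist G x z = 2" for x z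
    using that sym graph_dist_eq_2_iff by blast
  have partner: "z \<in> {a, b, c, d}" if "x \<in> {a, b, c, d}" "graph_dist G x z = 2" for x z
    using that verts uniq[of x z] c2 d2 swap[OF _ _ c2] swap[OF _ _ d2] by auto
  \<comment> \<open>Adjacency to a vertex outside the path spreads along the path.\<close>
  have spread: "(y, w) \<in> parcs G"
    if "(x, w) \<in> parcs G" "w \<notin> {a, b, c, d}" "(x, y) \<in> parcs G" "y \<in> {a, b, c, d}" for x y w
    using that dist2[of y x w] partner[of y w] sym by blast
  have "pverts G \<subseteq> {a, b, c, d}"
  proof
    fix y assume y: "y \<in> pverts G"
    show "y \<in> {a, b, c, d}"
    proof (rule ccontr)
      assume "y \<notin> {a, b, c, d}"
      then obtain s w where sw: "(s, w) \<in> parcs G" "s \<in> {a, b, c, d}" "w \<notin> {a, b, c, d}"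
        using connected_escape[OF conn, of a "{a, b, c, d}" y] a y by blast
      note sp = spread[OF _ sw(3)]
      have "(a, w) \<in> parcs G \<and> (d, w) \<in> parcs G"
        using sw(1,2) sp[of a b] sp[of b a] sp[of b c] sp[of c b] sp[of c d] sp[of d c]
          b(1,2) cd sym by blast
      then show False
        using dist2[of a w d] d sym by blast
    qed
  qed
  with verts have "pverts G = {a, b, c, d}" by blast
  moreover have "distinct [a, b, c, d]"
    using b cd d bd no_loops' by auto
  ultimately show "G \<simeq>\<^sub>g path_graph 4"
    using b cd bd d by (intro path_graph_4I)
qed

section \<open>Complements of perfect matchings\<close>

lemma pair_wf_cocktail_party_graph: "pair_wf_digraph (cocktail_party_graph k)"
  by unfold_locales (auto simp: cocktail_party_graph_def Let_def)

text \<open>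
  The labelling \<open>g\<close> presents the vertices of \<open>G\<close> as those of \<open>kP\<^sub>2\<close>, the first component naming the
  copy of \<open>P\<^sub>2\<close>.
\<close>

lemma cocktail_party_if_complement:
  assumes "pair_wf_digraph G" and g: "bij_betw g (pverts G) ({..<k} \<times> {..<2 :: nat})"
    and adj: "\<And>u v. u \<in> pverts G \<Longrightarrow> v \<in> pverts G \<Longrightarrow>
      (u, v) \<in> parcs G \<longleftrightarrow> fst (g u) \<noteq> fst (g v)"
  shows "G \<simeq>\<^sub>g cocktail_party_graph k"
proof -
  \<comment> \<open>The parties of \<open>CP\<^bsub>2k\<^esub>\<close> are numbered from 1, the copies of \<open>P\<^sub>2\<close> from 0.\<close>
  define r :: "nat \<times> nat \<Rightarrow> nat + nat"
    where "r = (\<lambda>(i, s). if s = 0 then Inl (Suc i) else Inr (Suc i))"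
  have "bij_betw r ({..<k} \<times> {..<2}) (pverts (cocktail_party_graph k))"
    unfolding bij_betw_def
  proof
    show "inj_on r ({..<k} \<times> {..<2})"
      by (auto simp: inj_on_def r_def split: if_splits)
    have "{..<k} \<times> {..<2 :: nat} = (\<lambda>i. (i, 0)) ` {..<k} \<union> (\<lambda>i. (i, 1)) ` {..<k}"
      by (auto simp: less_2_cases_iff)
    then have "r ` ({..<k} \<times> {..<2}) = Inl ` Suc ` {..<k} \<union> Inr ` Suc ` {..<k}"
      by (simp add: image_Un image_image r_def)
    then show "r ` ({..<k} \<times> {..<2}) = pverts (cocktail_party_graph k)"
      by (simp only: image_Suc_lessThan) (simp add: cocktail_party_graph_def Let_def)
  qed
  with g have bij: "bij_betw (r \<circ> g) (pverts G) (pverts (cocktail_party_graph k))"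
    by (rule bij_betw_trans)
  have r_adj: "(r x, r y) \<in> parcs (cocktail_party_graph k) \<longleftrightarrow> fst x \<noteq> fst y"
    if "x \<in> {..<k} \<times> {..<2}" "y \<in> {..<k} \<times> {..<2}" for x y
    using that by (cases x; cases y) (auto simp: cocktail_party_graph_def Let_def r_def)
  show ?thesis
    using assms(1) pair_wf_cocktail_party_graph bij
  proof (rule graph_isoI)
    fix u v assume "u \<in> pverts G" "v \<in> pverts G"
    then show "((r \<circ> g) u, (r \<circ> g) v) \<in> parcs (cocktail_party_graph k) \<longleftrightarrow> (u, v) \<in> parcs G"
      using bij_betwE[OF g] by (simp add: r_adj adj)
  qed
qed

theorem theorem3p1:
  fixes X :: "'a pair_pre_digraph" and k :: nat
  assumes "pair_graph X"
    and "connected (with_proj X)"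
    and "2 \<le> k"
    and "two_distance_graph X \<simeq>\<^sub>g disjoint_copies k (path_graph 2)"
  shows "(k = 2 \<longrightarrow> X \<simeq>\<^sub>g path_graph 4 \<or> X \<simeq>\<^sub>g cocktail_party_graph 2)
    \<and> (k \<ge> 3 \<longrightarrow> X \<simeq>\<^sub>g cocktail_party_graph k)"
proof -
  interpret pair_graph X by fact
  let ?D = "\<lambda>u v. graph_dist X u v = 2"
  obtain g where "bij_betw g (pverts (two_distance_graph X)) (pverts (disjoint_copies k (path_graph 2)))"
    and g_arcs: "\<And>u v. u \<in> pverts (two_distance_graph X) \<Longrightarrow> v \<in> pverts (two_distance_graph X) \<Longrightarrow>
      (g u, g v) \<in> parcs (disjoint_copies k (path_graph 2)) \<longleftrightarrow> (u, v) \<in> parcs (two_distance_graph X)"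
    using graph_iso_obtain_bij[OF assms(4)] by blast
  then have g: "bij_betw g (pverts X) ({..<k} \<times> {..<2})"
    by (simp add: two_distance_graph_def disjoint_copies_def path_graph_def)
  \<comment> \<open>Distinct vertices are at distance 2 exactly when they lie in the same copy of \<open>P\<^sub>2\<close>.\<close>
  have D_iff: "?D u v \<longleftrightarrow> u \<noteq> v \<and> fst (g u) = fst (g v)"
    if uv: "u \<in> pverts X" "v \<in> pverts X" for u v
  proof -
    have "?D u v \<longleftrightarrow> (g u, g v) \<in> parcs (disjoint_copies k (path_graph 2))"
      using g_arcs[of u v] uv by (simp add: two_distance_graph_def)
    also have "\<dots> \<longleftrightarrow> g u \<noteq> g v \<and> fst (g u) = fst (g v)"
    proof -
      have "g u \<in> {..<k} \<times> {..<2}" "g v \<in> {..<k} \<times> {..<2}"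
        using bij_betwE[OF g] uv by auto
      then show ?thesis
        by (cases "g u"; cases "g v") (auto simp: disjoint_copies_def path_graph_def)
    qed
    also have "g u \<noteq> g v \<longleftrightarrow> u \<noteq> v"
      using g uv by (auto simp: bij_betw_def dest: inj_onD)
    finally show ?thesis .
  qed
  have uniq: "v = w" if u: "u \<in> pverts X" and D: "?D u v" "?D u w" for u v w
  proof -
    have vw: "v \<in> pverts X" "w \<in> pverts X"
      using D u in_arcsD2 graph_dist_eq_2_iff by blast+
    then have "u \<noteq> v" "u \<noteq> w" "fst (g u) = fst (g v)" "fst (g u) = fst (g w)"
      using D_iff u D by blast+
    moreover from this have "g u \<noteq> g v" "g u \<noteq> g w"
      using g u vw by (auto simp: bij_betw_def dest: inj_onD)
    moreover have "snd (g u) < 2" "snd (g v) < 2" "snd (g w) < 2"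
      using bij_betwE[OF g] u vw by (metis SigmaE lessThan_iff snd_conv)+
    ultimately have "g v = g w"
      by (auto simp: prod_eq_iff)
    then show ?thesis
      using g vw by (auto simp: bij_betw_def dest: inj_onD)
  qed
  have "X \<simeq>\<^sub>g path_graph 4 \<or>
    (\<forall>u\<in>pverts X. \<forall>v\<in>pverts X. u \<noteq> v \<longrightarrow> (u, v) \<in> parcs X \<or> ?D u v)"
    using assms(2) uniq by (rule diameter_two_or_path4)
  then show ?thesis
  proof
    assume P4: "X \<simeq>\<^sub>g path_graph 4"
    then obtain f where "bij_betw f (pverts X) (pverts (path_graph 4))"
      by (rule graph_iso_obtain_bij)
    then have "card (pverts X) = 4"
      by (auto simp: path_graph_def dest: bij_betw_same_card)
    moreover have "card (pverts X) = k * 2"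
      using bij_betw_same_card[OF g] by (simp add: card_cartesian_product)
    ultimately have "k = 2" by simp
    with P4 show ?thesis by simp
  next
    assume near: "\<forall>u\<in>pverts X. \<forall>v\<in>pverts X. u \<noteq> v \<longrightarrow> (u, v) \<in> parcs X \<or> ?D u v"
    have "(u, v) \<in> parcs X \<longleftrightarrow> fst (g u) \<noteq> fst (g v)" if "u \<in> pverts X" "v \<in> pverts X" for u v
      using near that D_iff[of u v] no_loops' graph_dist_eq_2_iff[of u v] by metis
    with g have "X \<simeq>\<^sub>g cocktail_party_graph k"
      by (intro cocktail_party_if_complement) auto
    then show ?thesis by auto
  qed
qed

end
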